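(* Let $f(z)=\sum_{n\ge1}a_f(n)e^{2\pi i n z}$ be a normalized newform ($a_f(1)=1$) of even integer weight $k$ for $\Gamma_0(N)$, let $a(n)=a_f(n)/n^{(k-1)/2}$, and for each prime $p$ let $\theta_p\in[0,\pi]$ satisfy $a(p)=2\cos\theta_p$. For any prime $p$, the set $$\mathrm{Bad}(p,m^2)=\Big\{x\in\mathbb{R}:\ \inf_{m\in\mathbb{N}} m^2\,|a(p^m)-x|>0\Big\}$$ is winning in the interval $\big(0,\tfrac{1}{2\sin\theta_p}\big)$.
   Context: Schmidt's game on an interval $I\subseteq\mathbb{R}$ with parameters $\alpha,\beta\in(0,1)$: player B chooses a closed interval $B_0\subseteq I$; then alternately player A chooses a closed interval $A_s\subset B_s$ with $|A_s|=\alpha|B_s|$ and player B chooses a closed interval $B_{s+1}\subset A_s$ with $|B_{s+1}|=\beta|A_s|$, producing nested intervals $B_0\supset A_0\supset B_1\supset A_1\supset\cdots$. A set $X\subseteq I$ is $\alpha$-winning in $I$ if player A has a strategy ensuring that the unique point $\bigcap_s B_s$ lies in $X$ for every $\beta\in(0,1)$; $X$ is winning in $I$ if it is $\alpha$-winning in $I$ for some $\alpha\in(0,1)$. *)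

theory Defs
  imports "HOL-Complex_Analysis.Complex_Analysis"
begin

definition UHP :: "complex set" where
  "UHP = {z. Im z > 0}"

definition SL2Z :: "(int ^ 2 ^ 2) set" where
  "SL2Z = {A. det A = 1}"

definition Gamma0 :: "nat \<Rightarrow> (int ^ 2 ^ 2) set" where
  "Gamma0 N = {A \<in> SL2Z. int N dvd A $ 2 $ 1}"

definition moebius :: "int ^ 2 ^ 2 \<Rightarrow> complex \<Rightarrow> complex" where
  "moebius A z = (of_int (A $ 1 $ 1) * z + of_int (A $ 1 $ 2)) /
                 (of_int (A $ 2 $ 1) * z + of_int (A $ 2 $ 2))"

definition slash :: "int \<Rightarrow> (complex \<Rightarrow> complex) \<Rightarrow> int ^ 2 ^ 2 \<Rightarrow> complex \<Rightarrow> complex" where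
  "slash k f A z =
     (of_int (A $ 2 $ 1) * z + of_int (A $ 2 $ 2)) powi (- k) * f (moebius A z)"

text \<open>
  Forms are functions on all of \<open>complex\<close>, of which only the values on \<^const>\<open>UHP\<close> matter.
  The last conjunct is vanishing at the cusps: as the principal congruence subgroup of level
  \<open>N\<close> is normal and contained in \<open>\<Gamma>\<^sub>0(N)\<close>, every \<open>slash k f A\<close> has period \<open>N\<close>, and its expansion in
  \<open>exp (2 \<pi> i z / N)\<close> is required to have positive exponents only.
\<close>

definition cusp_forms :: "nat \<Rightarrow> int \<Rightarrow> (complex \<Rightarrow> complex) set" where
  "cusp_forms N k = {f.
     f holomorphic_on UHP \<and>
     (\<forall>A\<in>Gamma0 N. \<forall>z\<in>UHP. slash k f A z = f z) \<and>
     (\<forall>A\<in>SL2Z. \<exists>c :: nat \<Rightarrow> complex. \<forall>z\<in>UHP.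
        ((\<lambda>n. c n * exp (2 * of_real pi * \<i> * of_nat n * z / of_nat N))
           has_sum slash k f A z) {1..})}"

text \<open>
  The Hecke operator \<open>T\<^sub>n\<close> for trivial character, as a sum over \<open>a d = n\<close> with
  \<open>a = n div d\<close> prime to the level. For a prime \<open>n\<close> dividing \<open>N\<close> this is the operator \<open>U\<^sub>n\<close>.
\<close>

definition hecke ::
  "nat \<Rightarrow> int \<Rightarrow> nat \<Rightarrow> (complex \<Rightarrow> complex) \<Rightarrow> complex \<Rightarrow> complex" where
  "hecke N k n f z = of_nat n powi (k - 1) *
     (\<Sum>d | d dvd n \<and> coprime (n div d) N.
        of_nat d powi (- k) * (\<Sum>b<d. f ((of_nat (n div d) * z + of_nat b) / of_nat d)))"

definition fundamental_domain :: "complex set" where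
  "fundamental_domain = {z. Im z > 0 \<and> \<bar>Re z\<bar> \<le> 1 / 2 \<and> norm z \<ge> 1}"

definition Gamma0_cosets :: "nat \<Rightarrow> (int ^ 2 ^ 2) set set" where
  "Gamma0_cosets N = (\<lambda>A. (\<lambda>G. G ** A) ` Gamma0 N) ` SL2Z"

text \<open>
  The Petersson inner product, as an integral over the union of the translates of the standard
  fundamental domain of the full modular group by representatives of the finitely many cosets
  in \<open>\<Gamma>\<^sub>0(N) \<setminus> SL\<^sub>2(\<int>)\<close>. It is not divided by the volume, as it is only used for orthogonality.
  The integrand is \<open>\<Gamma>\<^sub>0(N)\<close>-invariant, so the choice of representatives is immaterial.
\<close>

definition petersson ::
  "nat \<Rightarrow> int \<Rightarrow> (complex \<Rightarrow> complex) \<Rightarrow> (complex \<Rightarrow> complex) \<Rightarrow> complex" where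
  "petersson N k f g = (\<Sum>C\<in>Gamma0_cosets N.
     LINT z:fundamental_domain|lborel.
       (let w = moebius (SOME A. A \<in> C) z
        in f w * cnj (g w) * of_real (Im w powi k / (Im z)\<^sup>2)))"

text \<open>
  The old subspace: the complex span of all \<open>z \<mapsto> g (d z)\<close> with \<open>g\<close> a cusp form
  of a level \<open>M\<close> properly dividing \<open>N\<close> and \<open>d\<close> dividing \<open>N / M\<close>.
\<close>

inductive_set oldforms :: "nat \<Rightarrow> int \<Rightarrow> (complex \<Rightarrow> complex) set"
  for N :: nat and k :: int where
  zero: "(\<lambda>z. 0) \<in> oldforms N k"
| lift: "M * d dvd N \<Longrightarrow> M \<noteq> N \<Longrightarrow> g \<in> cusp_forms M k \<Longrightarrow>
         (\<lambda>z. g (of_nat d * z)) \<in> oldforms N k"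
| add: "g \<in> oldforms N k \<Longrightarrow> h \<in> oldforms N k \<Longrightarrow> (\<lambda>z. g z + h z) \<in> oldforms N k"
| scale: "g \<in> oldforms N k \<Longrightarrow> (\<lambda>z. c * g z) \<in> oldforms N k"

definition is_newform :: "nat \<Rightarrow> int \<Rightarrow> (complex \<Rightarrow> complex) \<Rightarrow> bool" where
  "is_newform N k f \<longleftrightarrow>
     f \<in> cusp_forms N k \<and>
     (\<exists>z\<in>UHP. f z \<noteq> 0) \<and>
     (\<forall>g\<in>oldforms N k. petersson N k f g = 0) \<and>
     (\<forall>n\<ge>1. \<exists>l. \<forall>z\<in>UHP. hecke N k n f z = l * f z)"

definition has_fourier_coeffs :: "(complex \<Rightarrow> complex) \<Rightarrow> (nat \<Rightarrow> complex) \<Rightarrow> bool" where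
  "has_fourier_coeffs f c \<longleftrightarrow>
     (\<forall>z\<in>UHP. ((\<lambda>n. c n * exp (2 * of_real pi * \<i> * of_nat n * z)) has_sum f z) {1..})"

definition normalized_coeff :: "int \<Rightarrow> (nat \<Rightarrow> complex) \<Rightarrow> nat \<Rightarrow> complex" where
  "normalized_coeff k c n = c n / of_real (real n powr ((real_of_int k - 1) / 2))"

definition closed_interval :: "real set \<Rightarrow> bool" where
  "closed_interval J \<longleftrightarrow> (\<exists>a b. a < b \<and> J = {a..b})"

abbreviation len :: "real set \<Rightarrow> real" where
  "len J \<equiv> measure lborel J"

text \<open>
  A strategy for player A maps the nonempty list \<open>[B\<^sub>0, \<dots>, B\<^sub>s]\<close> of the moves of player B so far
  to the move \<open>A\<^sub>s\<close>. It must answer every such list by a legal move.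
\<close>

definition A_strategy :: "real \<Rightarrow> (real set list \<Rightarrow> real set) \<Rightarrow> bool" where
  "A_strategy \<alpha> \<sigma> \<longleftrightarrow>
     (\<forall>Bs. Bs \<noteq> [] \<and> closed_interval (last Bs) \<longrightarrow>
        closed_interval (\<sigma> Bs) \<and> \<sigma> Bs \<subseteq> last Bs \<and> len (\<sigma> Bs) = \<alpha> * len (last Bs))"

definition B_play ::
  "real \<Rightarrow> real set \<Rightarrow> (real set list \<Rightarrow> real set) \<Rightarrow> (nat \<Rightarrow> real set) \<Rightarrow> bool" where
  "B_play \<beta> I \<sigma> B \<longleftrightarrow>
     closed_interval (B 0) \<and> B 0 \<subseteq> I \<and>
     (\<forall>s. let A = \<sigma> (map B [0..<Suc s]) in
        closed_interval (B (Suc s)) \<and> B (Suc s) \<subseteq> A \<and> len (B (Suc s)) = \<beta> * len A)"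

definition alpha_winning_in :: "real \<Rightarrow> real set \<Rightarrow> real set \<Rightarrow> bool" where
  "alpha_winning_in \<alpha> I X \<longleftrightarrow> X \<subseteq> I \<and>
     (\<exists>\<sigma>. A_strategy \<alpha> \<sigma> \<and>
        (\<forall>\<beta>\<in>{0<..<1}. \<forall>B. B_play \<beta> I \<sigma> B \<longrightarrow> (\<exists>x\<in>X. (\<Inter>s. B s) = {x})))"

definition winning_in :: "real set \<Rightarrow> real set \<Rightarrow> bool" where
  "winning_in I X \<longleftrightarrow> (\<exists>\<alpha>\<in>{0<..<1}. alpha_winning_in \<alpha> I X)"

text \<open>The infimum is over positive \<open>m\<close>: including \<open>m = 0\<close> would make the set empty.\<close>

definition Bad :: "(nat \<Rightarrow> complex) \<Rightarrow> nat \<Rightarrow> real set" where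
  "Bad a p = {x. (INF m\<in>{1..}. (real m)\<^sup>2 * norm (a (p ^ m) - of_real x)) > 0}"

text \<open>
  The interval \<open>(0, 1 / (2 sin \<theta>))\<close>. The quotient is taken in \<^typ>\<open>ereal\<close>, so that for
  \<open>sin \<theta> = 0\<close> it is infinite and the interval is \<open>(0, \<infinity>)\<close>.
\<close>

definition target_interval :: "real \<Rightarrow> real set" where
  "target_interval \<theta> = {x. ereal x \<in> {0<..<1 / ereal (2 * sin \<theta>)}}"

end

theory Submission
  imports Defs
begin

text \<open>
  The eigenvalue equation of the Hecke operator at \<open>p\<close> gives \<open>a(p\<^sup>m) = a(p)\<^sup>m\<close> if \<open>p\<close> divides the level
  and \<open>a(p\<^sup>m) = sin((m + 1) \<theta>) / sin \<theta>\<close> otherwise. In the first case, and if \<open>sin \<theta> = 0\<close>, the values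
  have no positive accumulation point outside the sequence, and player A only needs to avoid the
  \<open>s\<close>-th value at stage \<open>s\<close>.

  In the remaining case write \<open>y n = sin(n \<theta>) / sin \<theta>\<close>, and for an interval \<open>B\<close> of length \<open>l\<close> let \<open>Q(l)\<close>
  be the least \<open>d > 0\<close> for which \<open>d \<theta>\<close> is within \<open>3 l\<close> of \<open>2 \<pi> \<int>\<close>. As \<open>sin\<close> is steep where its values are
  at most about \<open>1 / 2\<close>, for each sign of \<open>cos(n \<theta>)\<close> at most one point \<open>y n\<close> with \<open>n \<le> Q(l)\<close> is near \<open>B\<close>.
  Hence player A can keep a distance of \<open>l / 10\<close> from all of them with \<open>\<alpha> = 1 / 5\<close>. This move
  does not depend on the history or on \<open>\<beta>\<close>, and it even forces \<open>n |x - y n|\<close> to be bounded below.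
\<close>

subsection \<open>Strategies\<close>

lemma closed_interval_shrink:
  assumes "closed_interval B" "0 < \<alpha>" "\<alpha> < 1"
  shows "\<exists>A. closed_interval A \<and> A \<subseteq> B \<and> len A = \<alpha> * len B"
proof -
  obtain a b where ab: "a < b" "B = {a..b}"
    using assms(1) by (auto simp: closed_interval_def)
  have "\<alpha> * (b - a) \<le> 1 * (b - a)"
    using assms ab by (intro mult_right_mono) auto
  then have "a + \<alpha> * (b - a) \<le> b" by (simp add: algebra_simps)
  moreover have "0 < \<alpha> * (b - a)" using assms ab by simp
  ultimately have "closed_interval {a..a + \<alpha> * (b - a)} \<and> {a..a + \<alpha> * (b - a)} \<subseteq> B \<and>
      len {a..a + \<alpha> * (b - a)} = \<alpha> * len B"
    using ab by (auto simp: closed_interval_def)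
  then show ?thesis by blast
qed

text \<open>Reduces the game to a strategy that looks only at the last move of B and its stage
  \<open>s\<close>. \<open>G\<close> is the avoidance goal of a stage: it must be attainable on
  every closed interval inside \<open>I\<close>. The strategy is chosen before
  \<open>\<beta>\<close> is known, and \<open>outcome\<close> then sees intervals whose lengths
  decrease geometrically.\<close>

lemma alpha_winning_inI:
  fixes G :: "nat \<Rightarrow> real set \<Rightarrow> real set \<Rightarrow> bool"
  assumes "0 < \<alpha>" "\<alpha> < 1" "X \<subseteq> I"
    and move: "\<And>s B. closed_interval B \<Longrightarrow> B \<subseteq> I \<Longrightarrow>
      \<exists>A. closed_interval A \<and> A \<subseteq> B \<and> len A = \<alpha> * len B \<and> G s B A"
    and outcome: "\<And>\<beta> B A x. 0 < \<beta> \<Longrightarrow> \<beta> < 1 \<Longrightarrow> (\<And>s. closed_interval (B s)) \<Longrightarrow>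
      (\<And>s. B s \<subseteq> I) \<Longrightarrow> (\<And>s. len (B s) = len (B 0) * (\<alpha> * \<beta>) ^ s) \<Longrightarrow>
      (\<And>s. G s (B s) (A s)) \<Longrightarrow> (\<And>s. x \<in> A s) \<Longrightarrow> x \<in> I \<Longrightarrow> x \<in> X"
  shows "alpha_winning_in \<alpha> I X"
proof -
  define legal where
    "legal B A \<longleftrightarrow> closed_interval A \<and> A \<subseteq> B \<and> len A = \<alpha> * len B" for A B :: "real set"
  \<comment> \<open>The list starts with \<open>B 0\<close>, so its stage is
    \<open>length Bs - 1\<close>. The last branch keeps \<open>\<sigma>\<close> legal on lists whose
    last interval leaves \<open>I\<close>, where no good move is promised.\<close>
  define \<sigma> where "\<sigma> Bs =
      (if \<exists>A. legal (last Bs) A \<and> G (length Bs - 1) (last Bs) A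
       then SOME A. legal (last Bs) A \<and> G (length Bs - 1) (last Bs) A
       else SOME A. legal (last Bs) A)" for Bs
  have \<sigma>_legal: "legal (last Bs) (\<sigma> Bs)" if "closed_interval (last Bs)" for Bs
  proof (cases "\<exists>A. legal (last Bs) A \<and> G (length Bs - 1) (last Bs) A")
    case True
    then have "\<sigma> Bs = (SOME A. legal (last Bs) A \<and> G (length Bs - 1) (last Bs) A)"
      unfolding \<sigma>_def by (rule if_P)
    with someI_ex[OF True] show ?thesis by metis
  next
    case False
    have "\<exists>A. legal (last Bs) A"
      unfolding legal_def using closed_interval_shrink[OF that assms(1,2)] .
    moreover have "\<sigma> Bs = (SOME A. legal (last Bs) A)"
      using False unfolding \<sigma>_def by (rule if_not_P)
    ultimately show ?thesis by (metis someI_ex)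
  qed
  have \<sigma>_good: "G (length Bs - 1) (last Bs) (\<sigma> Bs)"
    if "closed_interval (last Bs)" "last Bs \<subseteq> I" for Bs
  proof -
    have ex: "\<exists>A. legal (last Bs) A \<and> G (length Bs - 1) (last Bs) A"
      using move[OF that] unfolding legal_def by blast
    then have "\<sigma> Bs = (SOME A. legal (last Bs) A \<and> G (length Bs - 1) (last Bs) A)"
      unfolding \<sigma>_def by (rule if_P)
    with someI_ex[OF ex] show ?thesis by metis
  qed
  have strategy: "A_strategy \<alpha> \<sigma>"
    unfolding A_strategy_def using \<sigma>_legal[unfolded legal_def] by blast
  have "\<exists>x\<in>X. (\<Inter>s. B s) = {x}" if \<beta>: "\<beta> \<in> {0<..<1}" and play: "B_play \<beta> I \<sigma> B" for \<beta> B
  proof -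
    define A where "A s = \<sigma> (map B [0..<Suc s])" for s
    have last_B: "last (map B [0..<Suc s]) = B s" for s by simp
    have step: "closed_interval (B (Suc s)) \<and> B (Suc s) \<subseteq> A s \<and> len (B (Suc s)) = \<beta> * len (A s)" for s
      using play by (simp add: B_play_def Let_def A_def)
    have cl: "closed_interval (B s)" for s
      using play step by (cases s) (auto simp: B_play_def)
    have leg: "legal (B s) (A s)" for s
      using \<sigma>_legal[of "map B [0..<Suc s]", unfolded last_B, OF cl]
      by (simp only: A_def)
    have B_A: "B (Suc s) \<subseteq> A s" "A s \<subseteq> B s" for s
      using step leg by (auto simp: legal_def)
    then have dec: "B n \<subseteq> B m" if "m \<le> n" for m n
      using lift_Suc_antimono_le[of B, OF _ that] B_A by blast
    have BI: "B s \<subseteq> I" for s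
      using play dec[of 0 s] by (auto simp: B_play_def)
    have len: "len (B s) = len (B 0) * (\<alpha> * \<beta>) ^ s" for s
    proof (induction s)
      case (Suc s)
      have "len (B (Suc s)) = \<beta> * (\<alpha> * len (B s))"
        using step[of s] leg[of s] by (simp add: legal_def)
      then show ?case using Suc by simp
    qed simp
    have good: "G s (B s) (A s)" for s
      using \<sigma>_good[of "map B [0..<Suc s]", unfolded last_B, OF cl BI]
      by (simp add: A_def del: upt_Suc)
    \<comment> \<open>Compactness gives a common point; the lengths tending to 0 make it the only
      one.\<close>
    have "\<Inter>(range B) \<noteq> {}"
    proof (rule compact_nest)
      show "compact (B n)" "B n \<noteq> {}" for n
        using cl[of n] by (auto simp: closed_interval_def)
    qed (use dec in auto)
    then obtain x where x: "\<And>s. x \<in> B s" by blast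
    have "y = x" if y: "\<And>s. y \<in> B s" for y
    proof -
      have "\<bar>y - x\<bar> \<le> len (B 0) * (\<alpha> * \<beta>) ^ s" for s
      proof -
        obtain a b where "a < b" "B s = {a..b}"
          using cl[of s] by (auto simp: closed_interval_def)
        then show ?thesis using x[of s] y[of s] len[of s] by auto
      qed
      moreover have "\<alpha> * \<beta> < 1 * 1"
        using assms(1,2) \<beta> by (intro mult_strict_mono) auto
      then have "(\<lambda>s. len (B 0) * (\<alpha> * \<beta>) ^ s) \<longlonglongrightarrow> len (B 0) * 0"
        using assms(1,2) \<beta> by (intro tendsto_mult tendsto_const LIMSEQ_realpow_zero) auto
      ultimately have "\<bar>y - x\<bar> \<le> len (B 0) * 0"
        by (meson LIMSEQ_le_const)
      then show ?thesis by simp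
    qed
    then have "(\<Inter>s. B s) = {x}" using x by auto
    moreover have "x \<in> X"
    proof (rule outcome[of \<beta> B A])
      show "x \<in> A s" for s using x[of "Suc s"] B_A by blast
      show "len (B s) = len (B 0) * (\<alpha> * \<beta>) ^ s" for s by (rule len)
      show "x \<in> I" using x[of 0] BI by blast
    qed (use \<beta> in \<open>auto intro: cl BI[THEN subsetD] good\<close>)
    ultimately show ?thesis by blast
  qed
  with strategy assms(3) show ?thesis unfolding alpha_winning_in_def by blast
qed

text \<open>
  There are at most two points to avoid, while the three candidates \<open>C i\<close> are \<open>len B / 5\<close> apart.
\<close>

lemma avoid_two_points:
  fixes P :: "nat \<Rightarrow> bool" and y :: "nat \<Rightarrow> real" and c :: "nat \<Rightarrow> bool"
  assumes "closed_interval B"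
    and uniq: "\<And>m n. P m \<Longrightarrow> P n \<Longrightarrow> c m = c n \<Longrightarrow> m \<noteq> n \<Longrightarrow>
      (\<exists>x\<in>B. \<bar>x - y m\<bar> < len B / 10) \<Longrightarrow> (\<exists>x\<in>B. \<bar>x - y n\<bar> < len B / 10) \<Longrightarrow> False"
  shows "\<exists>A. closed_interval A \<and> A \<subseteq> B \<and> len A = 1 / 5 * len B \<and>
    (\<forall>n. P n \<longrightarrow> (\<forall>x\<in>A. len B / 10 \<le> \<bar>x - y n\<bar>))"
proof -
  obtain a b where ab: "a < b" "B = {a..b}"
    using assms(1) by (auto simp: closed_interval_def)
  define l where "l = b - a"
  have l: "l > 0" "len B = l" using ab by (auto simp: l_def)
  define C where "C i = {a + real i * (2 * l / 5)..a + real i * (2 * l / 5) + l / 5}" for i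
  have legal: "closed_interval (C i)" "C i \<subseteq> B" "len (C i) = 1 / 5 * len B" if "i < 3" for i
  proof -
    have "real i * (2 * l / 5) \<le> 2 * (2 * l / 5)"
      using that l by (intro mult_right_mono) auto
    then have "a + real i * (2 * l / 5) + l / 5 \<le> b" using ab l_def by linarith
    moreover have "0 \<le> real i * (2 * l / 5)" using l by simp
    ultimately show "closed_interval (C i)" "C i \<subseteq> B" "len (C i) = 1 / 5 * len B"
      using ab(2) l by (simp_all add: C_def closed_interval_def)
  qed
  show ?thesis
  proof (rule ccontr)
    assume neg: "\<not> ?thesis"
    have "\<exists>n x. P n \<and> x \<in> C i \<and> \<bar>x - y n\<bar> < l / 10" if "i < 3" for i
      using neg legal[OF that] l by (meson not_le)
    then obtain n x where nx: "\<And>i. i < 3 \<Longrightarrow> P (n i) \<and> x i \<in> C i \<and> \<bar>x i - y (n i)\<bar> < l / 10"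
      by metis
    \<comment> \<open>Points of different candidates differ by at least \<open>l / 5\<close>, so
      they cannot both be closer than \<open>l / 10\<close> to the same value.\<close>
    have n_ne: "n i \<noteq> n j" if "i < j" "j < 3" for i j
    proof
      assume eq: "n i = n j"
      have "(real i + 1) * (2 * l / 5) \<le> real j * (2 * l / 5)"
        using that l by (intro mult_right_mono) auto
      then show False
        using nx[of i] nx[of j] that unfolding C_def eq by (auto simp: abs_if distrib_right split: if_splits)
    qed
    have c_ne: "c (n i) \<noteq> c (n j)" if "i < j" "j < 3" for i j
      using uniq[of "n i" "n j"] nx[of i] nx[of j] n_ne[OF that] legal(2)[of i] legal(2)[of j] that l
      by auto
    \<comment> \<open>Three pairwise different truth values cannot exist.\<close>
    show False using c_ne[of 0 1] c_ne[of 0 2] c_ne[of 1 2] by auto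
  qed
qed

lemma winning_avoid_countable:
  fixes v :: "nat \<Rightarrow> real"
  shows "alpha_winning_in (1 / 5) I (I - range v)"
proof (rule alpha_winning_inI[where G = "\<lambda>s B A. v s \<notin> A"])
  fix s B assume B: "closed_interval B"
  have "\<exists>A. closed_interval A \<and> A \<subseteq> B \<and> len A = 1 / 5 * len B \<and>
      (\<forall>n. n = s \<longrightarrow> (\<forall>x\<in>A. len B / 10 \<le> \<bar>x - v n\<bar>))"
    \<comment> \<open>Only the index \<open>s\<close> is to be avoided at stage \<open>s\<close>, so
      \<open>uniq\<close> holds vacuously.\<close>
    by (rule avoid_two_points[OF B, where c = "\<lambda>_. True"]) simp
  moreover have "0 < len B" using B by (auto simp: closed_interval_def)
  ultimately show "\<exists>A. closed_interval A \<and> A \<subseteq> B \<and> len A = 1 / 5 * len B \<and> v s \<notin> A"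
    by fastforce
next
  fix B :: "nat \<Rightarrow> real set" and A x
  assume "\<And>s. v s \<notin> A s" "\<And>s. x \<in> A s" "x \<in> I"
  then show "x \<in> I - range v" by blast
qed auto

subsection \<open>Distance to the nearest multiple of \<open>2 \<pi>\<close>\<close>

definition circle_norm :: "real \<Rightarrow> real" where
  "circle_norm t = \<bar>t - 2 * pi * of_int (round (t / (2 * pi)))\<bar>"

lemma circle_norm_nonneg: "0 \<le> circle_norm t"
  by (simp add: circle_norm_def)

lemma circle_norm_le: "circle_norm t \<le> \<bar>t - 2 * pi * of_int j\<bar>"
proof -
  have "\<bar>t - 2 * pi * of_int i\<bar> = 2 * pi * \<bar>t / (2 * pi) - of_int i\<bar>" for i :: int
    by (subst abs_of_nonneg[of "2 * pi", symmetric]) (simp_all flip: abs_mult add: field_simps)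
  then show ?thesis
    unfolding circle_norm_def using round_diff_minimal[of "t / (2 * pi)" j] by simp
qed

lemma circle_norm_mult_nat_le: "circle_norm (real n * t) \<le> real n * circle_norm t"
proof -
  have "real n * t - 2 * pi * of_int (int n * round (t / (2 * pi))) =
      real n * (t - 2 * pi * of_int (round (t / (2 * pi))))"
    by (simp add: algebra_simps)
  with circle_norm_le[of "real n * t" "int n * round (t / (2 * pi))"] show ?thesis
    by (simp add: circle_norm_def abs_mult)
qed

text \<open>The sine is 1-Lipschitz, and by periodicity \<open>t\<close> may be replaced by its
  residue \<open>e\<close> of least modulus.\<close>

lemma sin_add_diff_le: "\<bar>sin (s + t) - sin s\<bar> \<le> circle_norm t"
proof -
  define j where "j = round (t / (2 * pi))"
  define e where "e = t - 2 * pi * of_int j"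
  have "s + t = (s + e) + 2 * pi * of_int j" by (simp add: e_def)
  then have "sin (s + t) = sin (s + e)" using sin_cos_eq_iff by metis
  then have "\<bar>sin (s + t) - sin s\<bar> = 2 * (\<bar>sin (e / 2)\<bar> * \<bar>cos ((s + e + s) / 2)\<bar>)"
    by (simp add: sin_diff_sin abs_mult)
  also have "\<dots> \<le> 2 * (\<bar>e / 2\<bar> * 1)"
    by (intro mult_left_mono mult_mono abs_sin_x_le_abs_x abs_cos_le_one) auto
  also have "\<dots> = circle_norm t" by (simp add: circle_norm_def e_def j_def)
  finally show ?thesis .
qed

text \<open>A converse to \<open>sin_add_diff_le\<close>. On a branch with fixed sign of the cosine,
  \<open>arcsin\<close> inverts the sine up to reflection and periods, and its derivative on
  \<open>[-3/4, 3/4]\<close> is at most 4 / sqrt 7 < 2.\<close>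

lemma circle_norm_le_sin_diff:
  assumes "\<bar>sin s\<bar> \<le> 3 / 4" "\<bar>sin t\<bar> \<le> 3 / 4" "cos s > 0 \<longleftrightarrow> cos t > 0"
  shows "circle_norm (s - t) \<le> 2 * \<bar>sin s - sin t\<bar>"
proof -
  have arcsin_lip: "\<bar>arcsin u - arcsin v\<bar> \<le> 2 * \<bar>u - v\<bar>" if "\<bar>u\<bar> \<le> 3/4" "\<bar>v\<bar> \<le> 3/4" for u v
  proof -
    have "norm (arcsin u - arcsin v) \<le> 2 * norm (u - v)"
    proof (rule field_differentiable_bound[where S = "{-3/4..3/4}"])
      show "(arcsin has_field_derivative inverse (sqrt (1 - z\<^sup>2))) (at z within {- 3 / 4..3 / 4})"
        if "z \<in> {- 3 / 4..3 / 4}" for z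
        using that by (intro DERIV_arcsin[THEN has_field_derivative_at_within]) auto
      show "norm (inverse (sqrt (1 - z\<^sup>2))) \<le> 2" if z: "z \<in> {- 3 / 4..3 / 4}" for z
      proof -
        have "z\<^sup>2 \<le> (3/4)\<^sup>2" using z by (intro abs_le_square_iff[THEN iffD1]) auto
        then have "1 / 2 \<le> sqrt (1 - z\<^sup>2)"
          by (intro real_le_rsqrt) (simp add: power2_eq_square)
        then have "inverse (sqrt (1 - z\<^sup>2)) \<le> inverse (1 / 2)"
          by (intro le_imp_inverse_le) auto
        moreover have "0 \<le> inverse (sqrt (1 - z\<^sup>2))"
          using \<open>1 / 2 \<le> sqrt (1 - z\<^sup>2)\<close> by (intro inverse_nonnegative_iff_nonnegative[THEN iffD2]) linarith
        ultimately show ?thesis by simp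
      qed
    qed (use that in auto)
    then show ?thesis by simp
  qed
  have pos: "\<exists>j::int. s = arcsin (sin s) + 2 * pi * j" if "cos s \<ge> 0" for s
  proof -
    have "cos s = cos (arcsin (sin s))"
      using that by (simp add: cos_arcsin cos_squared_eq[symmetric])
    then show ?thesis by (subst sin_cos_eq_iff[symmetric]) simp
  qed
  have sgn: "cos s > 0 \<and> cos t > 0 \<or> cos s \<le> 0 \<and> cos t \<le> 0" using assms(3) by linarith
  then show ?thesis
  proof
    assume "cos s > 0 \<and> cos t > 0"
    then obtain i j :: int where "s = arcsin (sin s) + 2 * pi * i" "t = arcsin (sin t) + 2 * pi * j"
      using pos by (meson less_imp_le)
    then have "s - t - 2 * pi * of_int (i - j) = arcsin (sin s) - arcsin (sin t)"
      by (simp add: algebra_simps)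
    with circle_norm_le[of "s - t" "i - j"] arcsin_lip[OF assms(1,2)] show ?thesis by simp
  next
    \<comment> \<open>The reflection \<open>pi - s\<close> keeps the sine and makes the cosine
      nonnegative; it also reverses the sign of the difference, hence \<open>j - i\<close>.\<close>
    assume "cos s \<le> 0 \<and> cos t \<le> 0"
    then obtain i j :: int where "pi - s = arcsin (sin s) + 2 * pi * i"
        "pi - t = arcsin (sin t) + 2 * pi * j"
      using pos[of "pi - s"] pos[of "pi - t"] by auto
    then have "s - t - 2 * pi * of_int (j - i) = - (arcsin (sin s) - arcsin (sin t))"
      by (simp add: algebra_simps)
    with circle_norm_le[of "s - t" "j - i"] arcsin_lip[OF assms(1,2)] show ?thesis by simp
  qed
qed

section \<open>Return times of the rotation by \<theta>\<close>

lemma exists_circle_norm_le: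
  assumes "0 < \<epsilon>"
  shows "\<exists>d>0. circle_norm (real d * \<theta>) \<le> \<epsilon>"
proof -
  \<comment> \<open>Dirichlet's theorem for \<open>\<theta> / (2 * pi)\<close> gives an error below
    \<open>1 / N\<close>, which becomes \<open>2 * pi / N\<close> after rescaling; this should be at
    most \<open>\<epsilon>\<close>.\<close>
  define N where "N = Suc (nat \<lceil>2 * pi / \<epsilon>\<rceil>)"
  have "N > 0" by (simp add: N_def)
  have "2 * pi / \<epsilon> \<le> real N" unfolding N_def by linarith
  then have N: "2 * pi / real N \<le> \<epsilon>"
    using assms \<open>N > 0\<close> by (simp add: field_simps)
  from Dirichlet_approx[OF \<open>N > 0\<close>, of "\<theta> / (2 * pi)"]
  obtain h k where hk: "0 < k" "\<bar>of_int k * (\<theta> / (2 * pi)) - of_int h\<bar> < 1 / real N" .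
  have "\<bar>of_int k * \<theta> - 2 * pi * of_int h\<bar> = 2 * pi * \<bar>of_int k * (\<theta> / (2 * pi)) - of_int h\<bar>"
    by (subst abs_of_nonneg[of "2 * pi", symmetric]) (simp_all flip: abs_mult add: field_simps)
  also have "\<dots> \<le> 2 * pi * (1 / real N)"
    using hk by (intro mult_left_mono) auto
  also have "\<dots> \<le> \<epsilon>" using N by simp
  finally have "circle_norm (real (nat k) * \<theta>) \<le> \<epsilon>"
    using circle_norm_le[of "real (nat k) * \<theta>" h] hk by simp
  with hk show ?thesis by (intro exI[of _ "nat k"]) auto
qed

text \<open>For positive \<open>\<epsilon>\<close> its values are denominators of best rational
  approximations to \<open>\<theta> / (2 * pi)\<close>, so it replaces the continued fraction
  expansion.\<close>

definition first_return :: "real \<Rightarrow> real \<Rightarrow> nat" where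
  "first_return \<theta> \<epsilon> = (LEAST d. d > 0 \<and> circle_norm (real d * \<theta>) \<le> \<epsilon>)"

lemma first_return:
  assumes "0 < \<epsilon>"
  shows "first_return \<theta> \<epsilon> > 0" "circle_norm (real (first_return \<theta> \<epsilon>) * \<theta>) \<le> \<epsilon>"
  using LeastI_ex[OF exists_circle_norm_le[OF assms, of \<theta>]] by (auto simp: first_return_def)

lemma first_return_le:
  "d > 0 \<Longrightarrow> circle_norm (real d * \<theta>) \<le> \<epsilon> \<Longrightarrow> first_return \<theta> \<epsilon> \<le> d"
  unfolding first_return_def by (intro Least_le) auto

lemma first_return_antimono:
  "0 < \<epsilon> \<Longrightarrow> \<epsilon> \<le> \<epsilon>' \<Longrightarrow> first_return \<theta> \<epsilon>' \<le> first_return \<theta> \<epsilon>"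
  using first_return[of \<epsilon> \<theta>] by (intro first_return_le) auto

text \<open>
  Let \<open>q < q'\<close> be the two return times, with nearest multiples \<open>2 \<pi> j\<close> and \<open>2 \<pi> j'\<close>. If \<open>q' \<epsilon>\<close> were
  small, the integer \<open>q j' - q' j\<close> would vanish, making \<open>q\<close> an even better return time than \<open>q'\<close>.
\<close>

lemma first_return_jump:
  assumes "0 < \<epsilon>'" "\<epsilon>' \<le> \<epsilon>" "first_return \<theta> \<epsilon> < first_return \<theta> \<epsilon>'"
  shows "1 \<le> real (first_return \<theta> \<epsilon>') * \<epsilon>"
proof (rule ccontr)
  assume neg: "\<not> ?thesis"
  define q q' where "q = first_return \<theta> \<epsilon>" and "q' = first_return \<theta> \<epsilon>'"
  define j j' where "j = round (real q * \<theta> / (2 * pi))" and "j' = round (real q' * \<theta> / (2 * pi))"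
  define e e' where "e = real q * \<theta> - 2 * pi * of_int j" and "e' = real q' * \<theta> - 2 * pi * of_int j'"
  have pos: "0 < \<epsilon>" "0 < q" "0 < q'" "q < q'"
    using assms first_return(1)[of \<epsilon> \<theta>] by (auto simp: q_def q'_def)
  have e: "\<bar>e\<bar> \<le> \<epsilon>" "\<bar>e'\<bar> \<le> \<epsilon>'"
    using first_return(2)[OF pos(1), of \<theta>] first_return(2)[OF assms(1), of \<theta>]
    by (simp_all add: circle_norm_def e_def e'_def j_def j'_def q_def q'_def)
  \<comment> \<open>This combination of the two errors cancels \<open>\<theta>\<close> and leaves a
    multiple of \<open>2 * pi\<close>.\<close>
  have det: "2 * pi * of_int (int q * j' - int q' * j) = real q' * e - real q * e'"
    by (simp add: e_def e'_def algebra_simps)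
  have "\<bar>real q' * e - real q * e'\<bar> \<le> real q' * \<bar>e\<bar> + real q * \<bar>e'\<bar>"
    by (metis abs_mult abs_of_nat abs_triangle_ineq4)
  also have "\<dots> \<le> real q' * \<epsilon> + real q' * \<epsilon>"
    using e assms pos by (intro add_mono mult_mono) auto
  also have "\<dots> < 2"
    using neg unfolding q'_def by linarith
  finally have small: "2 * pi * \<bar>of_int (int q * j' - int q' * j)\<bar> < 2"
    unfolding det[symmetric] by (simp only: abs_mult) simp
  have "int q * j' - int q' * j = 0"
  proof (rule ccontr)
    assume "int q * j' - int q' * j \<noteq> 0"
    then have "2 * pi * 1 \<le> 2 * pi * \<bar>of_int (int q * j' - int q' * j)\<bar>"
      by (intro mult_left_mono) (linarith, simp)
    with small show False using pi_gt3 by linarith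
  qed
  then have "real q' * e = real q * e'" using det by simp
  then have "real q' * \<bar>e\<bar> = real q * \<bar>e'\<bar>"
    by (metis abs_mult abs_of_nat)
  also have "\<dots> \<le> real q' * \<bar>e'\<bar>"
    using pos by (intro mult_right_mono) auto
  finally have "\<bar>e\<bar> \<le> \<epsilon>'"
    using pos e by simp
  then have "first_return \<theta> \<epsilon>' \<le> q"
    using pos by (intro first_return_le) (auto simp: circle_norm_def e_def j_def)
  with pos show False by (simp add: q'_def)
qed

subsection \<open>Avoiding the values of the sine\<close>

text \<open>
  For \<open>n\<close> beyond the first stage, let \<open>q\<close> be the largest return time below \<open>n\<close> that occurs and reduce
  \<open>n\<close> modulo \<open>q\<close> to \<open>n\<^sub>0 \<le> q\<close>. Either \<open>y n\<close> is still close to \<open>y n\<^sub>0\<close>, which was avoided when \<open>q\<close>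
  first occurred, or \<open>n\<close> is so large that its avoidance at the stage of the next return time suffices.
\<close>

lemma badly_approximable_if_avoids:
  fixes y :: "nat \<Rightarrow> real" and \<theta> l\<^sub>0 \<gamma> K x :: real
  defines "l \<equiv> \<lambda>k. l\<^sub>0 * \<gamma> ^ k"
  assumes l0: "0 < l\<^sub>0" and \<gamma>: "0 < \<gamma>" "\<gamma> < 1" and K: "0 < K"
    and lip: "\<And>n d. \<bar>y (n + d) - y n\<bar> \<le> K * circle_norm (real d * \<theta>)"
    and far: "\<And>k n. 1 \<le> n \<Longrightarrow> n \<le> first_return \<theta> (3 * l k) \<Longrightarrow> l k / 10 \<le> \<bar>x - y n\<bar>"
  shows "\<exists>c>0. \<forall>n\<ge>1. c \<le> real n * \<bar>x - y n\<bar>"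
proof -
  define Q where "Q k = first_return \<theta> (3 * l k)" for k
  \<comment> \<open>\<open>c\<^sub>1\<close> bounds \<open>q * (l t / 10)\<close> below: by
    \<open>l\<^sub>0 / 10\<close> at stage 0 and by \<open>\<gamma> / 30\<close> after a jump of the
    return time. In \<open>c\<close>, the two terms serve the cases of small and large
    drift.\<close>
  define c\<^sub>1 where "c\<^sub>1 = min (l\<^sub>0 / 10) (\<gamma> / 30)"
  define c where "c = min (c\<^sub>1 / 2) (\<gamma> * c\<^sub>1 / (60 * K))"
  have c: "0 < c\<^sub>1" "0 < c" "c \<le> l\<^sub>0 / 10" "c \<le> c\<^sub>1 / 2" "c \<le> \<gamma> * c\<^sub>1 / (60 * K)"
    using l0 \<gamma> K by (auto simp: c_def c\<^sub>1_def)
  have l_pos: "0 < l k" for k using l0 \<gamma> by (simp add: l_def)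
  have l_Suc: "l (Suc k) = \<gamma> * l k" for k by (simp add: l_def)
  have l_anti: "l k' \<le> l k" if "k \<le> k'" for k k'
    using that l0 \<gamma> unfolding l_def by (intro mult_left_mono power_decreasing) auto
  have Q_pos: "0 < Q k" and Q_ret: "circle_norm (real (Q k) * \<theta>) \<le> 3 * l k" for k
    using first_return[of "3 * l k" \<theta>] l_pos[of k] by (auto simp: Q_def)
  have Q_mono: "Q k \<le> Q k'" if "k \<le> k'" for k k'
    unfolding Q_def using l_pos[of k'] l_anti[OF that] by (intro first_return_antimono) auto
  have "c \<le> real n * \<bar>x - y n\<bar>" if n: "1 \<le> n" for n
  proof (cases "n \<le> Q 0")
    case True
    then have "l 0 / 10 \<le> \<bar>x - y n\<bar>" using far n by (auto simp: Q_def)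
    moreover have "1 * \<bar>x - y n\<bar> \<le> real n * \<bar>x - y n\<bar>" using n by (intro mult_right_mono) auto
    ultimately show ?thesis using c by (simp add: l_def)
  next
    case False
    define S where "S = {m. m < n \<and> m \<in> range Q}"
    define q where "q = Max S"
    have "Q 0 \<in> S" using False by (simp add: S_def)
    then have S: "finite S" "S \<noteq> {}" by (auto simp: S_def)
    then have "q \<in> S" unfolding q_def by (rule Max_in)
    then have "q < n" "\<exists>t. Q t = q" by (auto simp: S_def)
    have q_max: "n \<le> Q k" if "q < Q k" for k
    proof (rule ccontr)
      assume "\<not> n \<le> Q k"
      then have "Q k \<in> S" by (auto simp: S_def)
      then show False using Max_ge[OF S(1), of "Q k"] that by (simp add: q_def)
    qed
    \<comment> \<open>As \<open>t\<close> is the first stage with return time \<open>q\<close>, the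
      previous stage has a smaller one, and \<open>first_return_jump\<close> bounds
      \<open>q * l t\<close> below.\<close>
    define t where "t = (LEAST t. Q t = q)"
    have t: "Q t = q" unfolding t_def using \<open>\<exists>t. Q t = q\<close> by (rule LeastI_ex)
    have q_pos: "0 < q" using Q_pos t by auto
    have q_l: "c\<^sub>1 \<le> real q * (l t / 10)"
    proof (cases t)
      case 0
      have "1 * (l t / 10) \<le> real q * (l t / 10)"
        using q_pos l_pos[of t] by (intro mult_right_mono) auto
      then show ?thesis using 0 by (simp add: c\<^sub>1_def l_def)
    next
      case (Suc t')
      have "Q t' \<noteq> q" using not_less_Least[of t' "\<lambda>t. Q t = q"] Suc by (auto simp: t_def)
      moreover have "Q t' \<le> Q t" using Suc by (intro Q_mono) auto
      ultimately have "first_return \<theta> (3 * l t') < first_return \<theta> (3 * l t)"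
        using t by (simp add: Q_def)
      then have "1 \<le> real (first_return \<theta> (3 * l t)) * (3 * l t')"
        using l_pos[of t] l_anti[of t' t] Suc by (intro first_return_jump) auto
      then have "\<gamma> * 1 \<le> \<gamma> * (real q * (3 * l t'))"
        using \<gamma> t by (intro mult_left_mono) (auto simp: Q_def)
      also have "\<dots> = 30 * (real q * (l t / 10))" using Suc l_Suc[of t'] by simp
      finally show ?thesis by (simp add: c\<^sub>1_def)
    qed
    \<comment> \<open>The shift by 1 gives residues in \<open>1..q\<close>: avoidance is known for
      positive indices up to and including \<open>Q t = q\<close>.\<close>
    define j n\<^sub>0 where "j = (n - 1) div q" and "n\<^sub>0 = (n - 1) mod q + 1"
    have n_eq: "n = n\<^sub>0 + j * q"
      using n mod_div_mult_eq[of "n - 1" q] by (simp add: j_def n\<^sub>0_def)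
    have n0: "1 \<le> n\<^sub>0" "n\<^sub>0 \<le> q"
      using q_pos by (auto simp: n\<^sub>0_def Suc_le_eq)
    define \<delta> where "\<delta> = circle_norm (real q * \<theta>)"
    have \<delta>: "0 \<le> \<delta>" "\<delta> \<le> 3 * l t"
      using Q_ret[of t] t circle_norm_nonneg by (auto simp: \<delta>_def)
    have "\<bar>y n - y n\<^sub>0\<bar> \<le> K * circle_norm (real (j * q) * \<theta>)"
      unfolding n_eq by (rule lip)
    also have "\<dots> \<le> K * (real j * \<delta>)"
      using K circle_norm_mult_nat_le[of j "real q * \<theta>"]
      by (intro mult_left_mono) (auto simp: \<delta>_def mult.assoc)
    finally have near: "\<bar>y n - y n\<^sub>0\<bar> \<le> K * (real j * \<delta>)" .
    have far0: "l t / 10 \<le> \<bar>x - y n\<^sub>0\<bar>"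
      using far[OF n0(1), of t] n0 t by (simp add: Q_def)
    \<comment> \<open>Either the drift from \<open>y n\<^sub>0\<close> to \<open>y n\<close> is at
      most half of the avoided distance \<open>l t / 10\<close>, or it is so large that
      \<open>\<delta> * n\<close> is bounded below.\<close>
    show ?thesis
    proof (cases "K * (real j * \<delta>) \<le> l t / 20")
      case True
      then have "l t / 20 \<le> \<bar>x - y n\<bar>" using near far0 by linarith
      then have "real q * (l t / 20) \<le> real n * \<bar>x - y n\<bar>"
        using \<open>q < n\<close> l_pos[of t] by (intro mult_mono) auto
      then show ?thesis using q_l c by simp
    next
      case False
      then have "\<delta> > 0" using \<delta> l_pos[of t] by (cases "\<delta> = 0") auto
      have "real q * (l t / 20) \<le> real q * (K * (real j * \<delta>))"
        using False by (intro mult_left_mono) auto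
      also have "\<dots> = K * \<delta> * real (j * q)" by simp
      also have "\<dots> \<le> K * \<delta> * real n"
        using K \<delta> n_eq by (intro mult_left_mono) auto
      finally have n\<delta>: "c\<^sub>1 \<le> 2 * K * \<delta> * real n" using q_l by simp
      have "0 < \<delta> / (3 * l\<^sub>0)" using \<open>\<delta> > 0\<close> l0 by simp
      then obtain k where "\<gamma> ^ k < \<delta> / (3 * l\<^sub>0)" using real_arch_pow_inv \<gamma> by blast
      then have ex: "\<exists>k. 3 * l k < \<delta>" using l0 by (auto simp: l_def field_simps)
      \<comment> \<open>At stage \<open>k\<close> the time \<open>q\<close> has just ceased to be a
        return time. Hence \<open>Q k > q\<close>, so \<open>n \<le> Q k\<close> by maximality of
        \<open>q\<close>, and \<open>y n\<close> is avoided at this stage. Minimality keeps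
        \<open>3 * l k\<close> at least \<open>\<gamma> * \<delta>\<close>.\<close>
      define k where "k = (LEAST k. 3 * l k < \<delta>)"
      have k: "3 * l k < \<delta>" unfolding k_def using ex by (rule LeastI_ex)
      have "t < k" using l_anti[of k t] k \<delta> by (cases "t < k") auto
      then obtain k' where k': "k = Suc k'" by (cases k) auto
      have "\<delta> \<le> 3 * l k'" using not_less_Least[of k' "\<lambda>k. 3 * l k < \<delta>"] k' by (auto simp: k_def)
      then have l_k: "\<gamma> * \<delta> \<le> 3 * l k"
        unfolding k' l_Suc using \<gamma> by simp
      have "Q k \<noteq> q" using Q_ret[of k] k by (auto simp: \<delta>_def)
      then have "q < Q k" using Q_mono[of t k] t \<open>t < k\<close> by simp
      then have "l k / 10 \<le> \<bar>x - y n\<bar>" using q_max n far by (auto simp: Q_def)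
      then have "\<gamma> * \<delta> / 30 \<le> \<bar>x - y n\<bar>" using l_k by simp
      then have "real n * (\<gamma> * \<delta> / 30) \<le> real n * \<bar>x - y n\<bar>" by (intro mult_left_mono) auto
      moreover have "\<gamma> * c\<^sub>1 / (60 * K) \<le> real n * (\<gamma> * \<delta> / 30)"
      proof -
        have "\<gamma> * c\<^sub>1 \<le> \<gamma> * (2 * K * \<delta> * real n)" using n\<delta> \<gamma> by (intro mult_left_mono) auto
        then show ?thesis using K by (simp add: field_simps)
      qed
      ultimately show ?thesis using c by linarith
    qed
  qed
  with c show ?thesis by blast
qed

text \<open>Scaling by \<open>sin \<theta>\<close> maps \<open>I\<close> to the interval from 0 to 1
  / 2. Values near \<open>B\<close> thus come from sines of modulus at most 3 / 4, and two of them
  on the same branch would force a return earlier than the first one.\<close>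

lemma winning_sin_quotients:
  fixes \<theta> :: real
  assumes s: "0 < sin \<theta>"
  defines "I \<equiv> {0<..<1 / (2 * sin \<theta>)}"
  shows "alpha_winning_in (1 / 5) I
    {x \<in> I. \<exists>c>0. \<forall>n\<ge>1. c \<le> real n * \<bar>x - sin (real n * \<theta>) / sin \<theta>\<bar>}"
proof -
  define y where "y n = sin (real n * \<theta>) / sin \<theta>" for n
  have sin_y: "sin (real n * \<theta>) = sin \<theta> * y n" for n using s by (simp add: y_def)
  define G :: "nat \<Rightarrow> real set \<Rightarrow> real set \<Rightarrow> bool" where
    "G s B A \<longleftrightarrow> (\<forall>n. 1 \<le> n \<and> n \<le> first_return \<theta> (3 * len B) \<longrightarrow> (\<forall>x\<in>A. len B / 10 \<le> \<bar>x - y n\<bar>))"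
    for s B A
  have "alpha_winning_in (1 / 5) I {x \<in> I. \<exists>c>0. \<forall>n\<ge>1. c \<le> real n * \<bar>x - y n\<bar>}"
  proof (rule alpha_winning_inI[where G = G])
    fix B assume B: "closed_interval B" "B \<subseteq> I"
    obtain a b where ab: "a < b" "B = {a..b}"
      using B(1) by (auto simp: closed_interval_def)
    have len: "len B = b - a" using ab by simp
    have "a \<in> I" "b \<in> I" using ab B(2) by auto
    then have I: "0 < sin \<theta> * a" "sin \<theta> * b < 1 / 2" using s by (auto simp: I_def field_simps)
    have small: "\<bar>sin (real n * \<theta>)\<bar> \<le> 3 / 4" if x: "x \<in> B" "\<bar>x - y n\<bar> < len B / 10" for n x
    proof -
      have "a - (b - a) / 10 \<le> y n" "y n \<le> b + (b - a) / 10"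
        using x ab(2) unfolding len abs_less_iff atLeastAtMost_iff by (simp, linarith)+
      then have "sin \<theta> * (a - (b - a) / 10) \<le> sin \<theta> * y n" "sin \<theta> * y n \<le> sin \<theta> * (b + (b - a) / 10)"
        using s by auto
      then have "sin \<theta> * a - (sin \<theta> * b - sin \<theta> * a) / 10 \<le> sin \<theta> * y n"
          "sin \<theta> * y n \<le> sin \<theta> * b + (sin \<theta> * b - sin \<theta> * a) / 10"
        by (simp_all add: algebra_simps)
      moreover have "\<bar>u\<bar> \<le> 3 / 4"
        if "v - (w - v) / 10 \<le> u" "u \<le> w + (w - v) / 10" "0 < v" "w < 1 / 2" for u v w :: real
        using that unfolding abs_le_iff by (simp add: field_simps)
      ultimately show ?thesis using I unfolding sin_y by blast
    qed
    have uniq: False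
      if mn: "1 \<le> m" "m < n" "n \<le> first_return \<theta> (3 * len B)"
        and c: "cos (real m * \<theta>) > 0 \<longleftrightarrow> cos (real n * \<theta>) > 0"
        and xx: "x \<in> B" "\<bar>x - y m\<bar> < len B / 10" "x' \<in> B" "\<bar>x' - y n\<bar> < len B / 10" for m n x x'
    proof -
      have "circle_norm (real n * \<theta> - real m * \<theta>) \<le> 2 * \<bar>sin (real n * \<theta>) - sin (real m * \<theta>)\<bar>"
        using small[OF xx(1,2)] small[OF xx(3,4)] c by (intro circle_norm_le_sin_diff) auto
      also have "\<dots> = 2 * (sin \<theta> * \<bar>y n - y m\<bar>)"
        using s unfolding sin_y by (simp flip: right_diff_distrib add: abs_mult)
      \<comment> \<open>Both values are within \<open>len B / 10\<close> of \<open>B\<close>, so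
        they differ by less than \<open>6 / 5 * len B\<close>. With the Lipschitz factor 2 this
        accounts for the threshold \<open>3 * len B\<close>.\<close>
      also have "\<dots> \<le> 2 * (1 * (3 / 2 * len B))"
      proof (intro mult_left_mono mult_mono)
        show "\<bar>y n - y m\<bar> \<le> 3 / 2 * len B"
          using xx ab len by (auto simp: abs_if split: if_splits)
      qed (use s in auto)
      finally have "circle_norm (real (n - m) * \<theta>) \<le> 3 * len B"
        using mn by (simp add: of_nat_diff left_diff_distrib)
      then have "first_return \<theta> (3 * len B) \<le> n - m"
        using mn by (intro first_return_le) auto
      moreover have "0 < first_return \<theta> (3 * len B)" using first_return ab len by simp
      ultimately show False using mn by linarith
    qed
    show "\<exists>A. closed_interval A \<and> A \<subseteq> B \<and> len A = 1 / 5 * len B \<and> G s B A" for s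
      unfolding G_def
    proof (rule avoid_two_points[OF B(1), where c = "\<lambda>n. cos (real n * \<theta>) > 0"], goal_cases)
      case (1 m n)
      then show False
        using uniq[of m n] uniq[of n m] by (cases m n rule: linorder_cases) blast+
    qed
  next
    fix \<beta> B A x
    assume \<beta>: "0 < (\<beta>::real)" "\<beta> < 1" and cl: "\<And>s. closed_interval (B s)"
      and len: "\<And>s. len (B s) = len (B 0) * (1 / 5 * \<beta>) ^ s"
      and good: "\<And>s. G s (B s) (A s)" "\<And>s. x \<in> A s" and "x \<in> I"
    have len0: "0 < len (B 0)" using cl[of 0] by (auto simp: closed_interval_def)
    have lip: "\<bar>y (n + d) - y n\<bar> \<le> 1 / sin \<theta> * circle_norm (real d * \<theta>)" for n d
    proof -
      have "y (n + d) - y n = (sin (real n * \<theta> + real d * \<theta>) - sin (real n * \<theta>)) / sin \<theta>"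
        by (simp add: y_def algebra_simps diff_divide_distrib)
      then show ?thesis
        using sin_add_diff_le[of "real n * \<theta>" "real d * \<theta>"] s by (simp add: divide_right_mono)
    qed
    have far: "len (B 0) * (1 / 5 * \<beta>) ^ k / 10 \<le> \<bar>x - y n\<bar>"
      if "1 \<le> n" "n \<le> first_return \<theta> (3 * (len (B 0) * (1 / 5 * \<beta>) ^ k))" for k n
      using good[of k] that unfolding G_def len[of k] by blast
    have "\<exists>c>0. \<forall>n\<ge>1. c \<le> real n * \<bar>x - y n\<bar>"
      \<comment> \<open>Here \<open>\<gamma>\<close> is \<open>1 / 5 * \<beta>\<close> and
        \<open>K\<close> is \<open>1 / sin \<theta>\<close>.\<close>
      by (rule badly_approximable_if_avoids[OF len0 _ _ _ lip far]) (use \<beta> s in auto)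
    then show "x \<in> {x \<in> I. \<exists>c>0. \<forall>n\<ge>1. c \<le> real n * \<bar>x - y n\<bar>}" using \<open>x \<in> I\<close> by simp
  qed auto
  then show ?thesis by (simp add: y_def)
qed

subsection \<open>Coefficients at prime powers\<close>

lemma has_sum_sum:
  fixes f :: "'i \<Rightarrow> 'a \<Rightarrow> 'b :: topological_comm_monoid_add"
  assumes "\<And>i. i \<in> I \<Longrightarrow> (f i has_sum s i) A"
  shows "((\<lambda>x. \<Sum>i\<in>I. f i x) has_sum (\<Sum>i\<in>I. s i)) A"
  using assms by (induction I rule: infinite_finite_induct) (auto intro: has_sum_add)

text \<open>Orthogonality of additive characters, as a geometric sum in \<open>w\<close>; it will
  select the exponents divisible by \<open>p\<close>.\<close>

lemma root_of_unity_sum: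
  fixes p n :: nat
  assumes "p > 0"
  shows "(\<Sum>b<p. exp (2 * of_real pi * \<i> * of_nat n * (of_nat b / of_nat p))) =
    (if p dvd n then of_nat p else 0 :: complex)"
proof -
  define w where "w = exp (2 * of_real pi * \<i> * of_nat n / of_nat p :: complex)"
  have pow: "exp (2 * of_real pi * \<i> * of_nat n * (of_nat b / of_nat p)) = w ^ b" for b
    by (simp add: w_def flip: exp_of_nat_mult) (simp add: field_simps)
  have "w ^ p = exp (2 * of_real pi * \<i> * of_nat n)"
    using assms by (simp add: w_def flip: exp_of_nat_mult)
  also have "\<dots> = 1"
    using exp_integer_2pi[of "of_nat n"] by (simp add: mult_ac)
  finally have "w ^ p = 1" .
  have w1: "w = 1 \<longleftrightarrow> p dvd n"
  proof
    assume "p dvd n"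
    then obtain m where "n = p * m" by blast
    then show "w = 1"
      using assms exp_integer_2pi[of "of_nat m"] by (simp add: w_def mult_ac)
  next
    assume "w = 1"
    then obtain j :: int where "2 * pi * real n / real p = real_of_int (2 * j) * pi"
      unfolding w_def exp_eq_1 by auto
    then have "real n = real_of_int j * real p" using assms by (simp add: field_simps)
    then have "int n = j * int p" by (metis of_int_eq_iff of_int_mult of_int_of_nat_eq)
    then show "p dvd n" by (metis dvd_triv_right int_dvd_int_iff)
  qed
  show ?thesis
  proof (cases "w = 1")
    case True
    then show ?thesis using w1 unfolding pow by simp
  next
    case False
    then have "(\<Sum>b<p. w ^ b) = 0" using \<open>w ^ p = 1\<close> by (simp add: geometric_sum)
    then show ?thesis using False w1 unfolding pow by simp
  qed
qed

text \<open>In the variable \<open>w = exp (2 * pi * \<i> * z)\<close>, which ranges over the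
  punctured unit disc, the difference of the expansions is a power series that vanishes
  identically.\<close>

lemma fourier_coeffs_unique:
  assumes "has_fourier_coeffs f c" "has_fourier_coeffs f d" "n \<ge> 1"
  shows "c n = d n"
proof -
  \<comment> \<open>The expansions start at 1, so the values of \<open>c\<close> and
    \<open>d\<close> at 0 are arbitrary and are masked.\<close>
  define b where "b n = (if n = 0 then 0 else c n - d n)" for n
  have sums: "(\<lambda>n. b n * w ^ n) sums 0" if w: "norm w < 1" for w
  proof (cases "w = 0")
    case True
    have "(\<lambda>n. b n * w ^ n) = (\<lambda>n. 0)" by (auto simp: b_def True)
    then show ?thesis by simp
  next
    case False
    define z where "z = Ln w / (2 * of_real pi * \<i>)"
    have "z = of_real (1 / (2 * pi)) * (- \<i> * Ln w)" by (simp add: z_def field_simps)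
    then have "Im z = - ln (norm w) / (2 * pi)" using False by simp
    then have "z \<in> UHP" using w False by (simp add: UHP_def divide_neg_pos)
    moreover have e: "exp (2 * of_real pi * \<i> * of_nat n * z) = w ^ n" for n
      using False by (simp add: z_def exp_of_nat_mult mult_ac)
    ultimately have "((\<lambda>n. c n * w ^ n) has_sum f z) {1..}" "((\<lambda>n. d n * w ^ n) has_sum f z) {1..}"
      using assms(1,2) unfolding has_fourier_coeffs_def by fastforce+
    then have "((\<lambda>n. c n * w ^ n + - (d n * w ^ n)) has_sum f z + - f z) {1..}"
      by (intro has_sum_add has_sum_uminusI)
    then have "((\<lambda>n. b n * w ^ n) has_sum 0) UNIV"
      by (subst has_sum_cong_neutral[where S = UNIV and T = "{1..}"])
        (auto simp: b_def algebra_simps not_le)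
    then show ?thesis by (rule has_sum_imp_sums)
  qed
  have "b n = 0"
  proof (rule ccontr)
    assume "b n \<noteq> 0"
    have "(\<lambda>n. b n * (x - 0) ^ n) sums 0" if "norm (x - 0) < 1" for x
      using sums that by simp
    \<comment> \<open>A nonzero coefficient would make 0 an isolated zero of the zero
      function.\<close>
    from powser_0_nonzero[OF zero_less_one this refl \<open>b n \<noteq> 0\<close>] assms(3)
    obtain s where s: "0 < s" "\<And>z::complex. z \<in> cball 0 s - {0} \<Longrightarrow> (0::complex) \<noteq> 0"
      by auto
    then show False using s(2)[of "of_real s"] by simp
  qed
  then show ?thesis using assms(3) by (simp add: b_def)
qed

lemma hecke_prime:
  assumes "prime p"
  shows "hecke N k p f z = of_nat p powi (k - 1) *
    ((if p dvd N then 0 else f (of_nat p * z)) +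
     of_nat p powi (- k) * (\<Sum>b<p. f ((z + of_nat b) / of_nat p)))"
proof -
  have p: "p > 1" using assms prime_gt_1_nat by blast
  have "{d. d dvd p \<and> coprime (p div d) N} = (if p dvd N then {p} else {1, p})"
    using assms p prime_imp_coprime[OF assms, of N]
    by (auto simp: prime_nat_iff not_coprimeI[of p p N])
  then show ?thesis
    using p by (simp add: hecke_def)
qed

text \<open>Summing over the translates \<open>(z + b) / p\<close> keeps the exponents divisible by
  \<open>p\<close> and divides them by \<open>p\<close>; the dilation \<open>p * z\<close>
  multiplies exponents by \<open>p\<close>. Both sums are reindexed along the multiples of
  \<open>p\<close>.\<close>

lemma hecke_prime_fourier:
  assumes f: "has_fourier_coeffs f c" and p: "prime p"
  shows "has_fourier_coeffs (hecke N k p f)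
    (\<lambda>n. c (p * n) + (if p dvd n \<and> \<not> p dvd N then of_nat p powi (k - 1) * c (n div p) else 0))"
  unfolding has_fourier_coeffs_def
proof
  fix z assume z: "z \<in> UHP"
  define e where "e w n = exp (2 * of_real pi * \<i> * of_nat n * w)" for w :: complex and n :: nat
  have p0: "p > 0" using p prime_gt_0_nat by blast
  have f': "((\<lambda>n. c n * e w n) has_sum f w) {1..}" if "w \<in> UHP" for w
    using f that by (simp add: has_fourier_coeffs_def e_def)
  have inj: "inj_on ((*) p) {1..}" using p0 by (simp add: inj_on_def)
  have e_mult: "e (of_nat p * w) n = e w (p * n)" for w n
    by (simp add: e_def mult_ac)
  have "((\<lambda>n. \<Sum>b<p. c n * e ((z + of_nat b) / of_nat p) n) has_sum
      (\<Sum>b<p. f ((z + of_nat b) / of_nat p))) {1..}"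
    using z p0 by (intro has_sum_sum f') (auto simp: UHP_def)
  moreover have "(\<Sum>b<p. c n * e ((z + of_nat b) / of_nat p) n) =
      (if p dvd n then of_nat p * (c n * e (z / of_nat p) n) else 0)" for n
  proof -
    have "e ((z + of_nat b) / of_nat p) n =
        e (z / of_nat p) n * exp (2 * of_real pi * \<i> * of_nat n * (of_nat b / of_nat p))" for b
      by (simp add: e_def add_divide_distrib distrib_left exp_add)
    then have "(\<Sum>b<p. c n * e ((z + of_nat b) / of_nat p) n) = c n * e (z / of_nat p) n *
        (\<Sum>b<p. exp (2 * of_real pi * \<i> * of_nat n * (of_nat b / of_nat p)))"
      by (simp add: sum_distrib_left mult_ac)
    then show ?thesis unfolding root_of_unity_sum[OF p0] by (simp add: mult_ac)
  qed
  ultimately have "((\<lambda>n. if p dvd n then of_nat p * (c n * e (z / of_nat p) n) else 0) has_sum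
      (\<Sum>b<p. f ((z + of_nat b) / of_nat p))) {1..}"
    by simp
  then have "((\<lambda>n. of_nat p * (c n * e (z / of_nat p) n)) has_sum
      (\<Sum>b<p. f ((z + of_nat b) / of_nat p))) ((*) p ` {1..})"
    by (rule has_sum_cong_neutral[THEN iffD1, rotated -1]) (use p0 in \<open>auto elim!: dvdE\<close>)
  then have "((\<lambda>n. of_nat p * (c (p * n) * e (of_nat p * (z / of_nat p)) n)) has_sum
      (\<Sum>b<p. f ((z + of_nat b) / of_nat p))) {1..}"
    unfolding has_sum_reindex[OF inj] e_mult by (simp add: o_def)
  then have sum1: "((\<lambda>n. of_nat p powi (k - 1) * (of_nat p powi (- k) * (of_nat p * (c (p * n) * e z n)))) has_sum
      of_nat p powi (k - 1) * (of_nat p powi (- k) * (\<Sum>b<p. f ((z + of_nat b) / of_nat p)))) {1..}"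
    using p0 by (intro has_sum_cmult_right) simp
  have "of_nat p powi (k - 1) * (of_nat p powi (- k) * (of_nat p * u)) = u" for u :: complex
    using p0 by (simp add: power_int_diff power_int_minus field_simps)
  with sum1 have sum1: "((\<lambda>n. c (p * n) * e z n) has_sum
      of_nat p powi (k - 1) * (of_nat p powi (- k) * (\<Sum>b<p. f ((z + of_nat b) / of_nat p)))) {1..}"
    by simp
  have "((\<lambda>n. c n * e z (p * n)) has_sum f (of_nat p * z)) {1..}"
    using f'[of "of_nat p * z"] z p0 by (simp add: UHP_def e_mult)
  then have "(((\<lambda>n. c (n div p) * e z n) \<circ> (*) p) has_sum f (of_nat p * z)) {1..}"
    using p0 by (simp add: o_def)
  then have "((\<lambda>n. c (n div p) * e z n) has_sum f (of_nat p * z)) ((*) p ` {1..})"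
    unfolding has_sum_reindex[OF inj] .
  then have "((\<lambda>n. if p dvd n then c (n div p) * e z n else 0) has_sum f (of_nat p * z)) {1..}"
    by (rule has_sum_cong_neutral[THEN iffD1, rotated -1]) (use p0 in \<open>auto elim!: dvdE\<close>)
  then have "((\<lambda>n. of_nat p powi (k - 1) * (if p dvd n then c (n div p) * e z n else 0)) has_sum
      of_nat p powi (k - 1) * f (of_nat p * z)) {1..}"
    by (rule has_sum_cmult_right)
  then have sum2: "((\<lambda>n. if p dvd N then 0 else of_nat p powi (k - 1) * (if p dvd n then c (n div p) * e z n else 0))
      has_sum (if p dvd N then 0 else of_nat p powi (k - 1) * f (of_nat p * z))) {1..}"
    by simp
  have term_eq: "(c (p * n) + (if p dvd n \<and> \<not> p dvd N then of_nat p powi (k - 1) * c (n div p) else 0)) * e z n =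
      c (p * n) * e z n +
      (if p dvd N then 0 else of_nat p powi (k - 1) * (if p dvd n then c (n div p) * e z n else 0))" for n
    by (simp add: distrib_right mult.assoc)
  have "hecke N k p f z =
      of_nat p powi (k - 1) * (of_nat p powi (- k) * (\<Sum>b<p. f ((z + of_nat b) / of_nat p))) +
      (if p dvd N then 0 else of_nat p powi (k - 1) * f (of_nat p * z))"
    unfolding hecke_prime[OF p] by (simp add: distrib_left)
  with has_sum_add[OF sum1 sum2]
  have "((\<lambda>n. (c (p * n) + (if p dvd n \<and> \<not> p dvd N then of_nat p powi (k - 1) * c (n div p) else 0)) * e z n)
      has_sum hecke N k p f z) {1..}"
    unfolding term_eq by simp
  then show "((\<lambda>n. (c (p * n) + (if p dvd n \<and> \<not> p dvd N then of_nat p powi (k - 1) * c (n div p) else 0)) *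
      exp (2 * of_real pi * \<i> * of_nat n * z)) has_sum hecke N k p f z) {1..}"
    by (simp add: e_def)
qed

text \<open>Compares coefficients in the eigenvalue equation. At \<open>n = 1\<close> the second
  term is absent, and \<open>c 1 = 1\<close> identifies the eigenvalue as
  \<open>c p\<close>.\<close>

lemma newform_coeff_recurrence:
  assumes newform: "is_newform N k f" and f: "has_fourier_coeffs f c" "c 1 = 1"
    and p: "prime p" and n: "n \<ge> 1"
  shows "c (p * n) = c p * c n -
    (if p dvd n \<and> \<not> p dvd N then of_nat p powi (k - 1) * c (n div p) else 0)"
proof -
  define d where
    "d n = c (p * n) + (if p dvd n \<and> \<not> p dvd N then of_nat p powi (k - 1) * c (n div p) else 0)" for n
  have "p \<ge> 1" using prime_ge_1_nat[OF p] .
  with newform obtain l where l: "\<forall>z\<in>UHP. hecke N k p f z = l * f z"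
    unfolding is_newform_def by meson
  have "has_fourier_coeffs (hecke N k p f) (\<lambda>n. l * c n)"
    unfolding has_fourier_coeffs_def
  proof
    fix z assume z: "z \<in> UHP"
    show "((\<lambda>n. l * c n * exp (2 * of_real pi * \<i> * of_nat n * z)) has_sum hecke N k p f z) {1..}"
      using has_sum_cmult_right[OF f(1)[unfolded has_fourier_coeffs_def, rule_format, OF z], of l] z l
      by (simp add: mult.assoc)
  qed
  moreover have "has_fourier_coeffs (hecke N k p f) d"
    unfolding d_def by (rule hecke_prime_fourier[OF f(1) p])
  ultimately have eq: "d n = l * c n" if "n \<ge> 1" for n
    using fourier_coeffs_unique that by blast
  from eq[of 1] have "l = c p" using f(2) prime_gt_1_nat[OF p] by (simp add: d_def)
  with eq[OF n] show ?thesis by (simp add: d_def algebra_simps)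
qed

section \<open>Closed forms for the normalized coefficients\<close>

lemma newform_prime_powers_dvd_level:
  assumes newform: "is_newform N k f" "has_fourier_coeffs f c" "c 1 = 1"
    and p: "prime p" "p dvd N"
  shows "normalized_coeff k c (p ^ m) = normalized_coeff k c p ^ m"
proof (induction m)
  case (Suc m)
  have "c (p ^ Suc m) = c p * c (p ^ m)"
    using newform_coeff_recurrence[OF newform p(1), of "p ^ m"] p prime_gt_0_nat[OF p(1)]
    by (simp add: Suc_le_eq)
  then have "normalized_coeff k c (p ^ Suc m) = normalized_coeff k c p * normalized_coeff k c (p ^ m)"
    by (simp add: normalized_coeff_def powr_mult)
  then show ?case using Suc by simp
qed (use assms(3) in \<open>simp add: normalized_coeff_def\<close>)

text \<open>The normalization divides the coefficient at \<open>p ^ n\<close> by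
  \<open>r ^ n\<close>, and \<open>r\<^sup>2 = p powi (k - 1)\<close> cancels the weight
  factor.\<close>

lemma newform_prime_powers_recurrence:
  assumes newform: "is_newform N k f" "has_fourier_coeffs f c" "c 1 = 1"
    and p: "prime p" "\<not> p dvd N"
  shows "normalized_coeff k c (p ^ Suc (Suc m)) =
    normalized_coeff k c p * normalized_coeff k c (p ^ Suc m) - normalized_coeff k c (p ^ m)"
proof -
  define r where "r = real p powr ((real_of_int k - 1) / 2)"
  have p0: "p > 0" using p prime_gt_0_nat by blast
  then have "r > 0" by (simp add: r_def)
  have coeff: "normalized_coeff k c (p ^ n) = c (p ^ n) / of_real (r ^ n)" for n
    using p0 by (simp add: normalized_coeff_def r_def powr_realpow[symmetric] powr_powr mult.commute)
  have "r ^ 2 = real p powr (real_of_int k - 1)"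
    using p0 by (simp add: r_def power2_eq_square flip: powr_add)
  also have "\<dots> = real p powi (k - 1)"
    using powr_real_of_int'[of "real p" "k - 1"] p0 by simp
  finally have "of_real (r ^ 2) = (of_real (real p powi (k - 1)) :: complex)"
    by (rule arg_cong)
  then have r2: "of_nat p powi (k - 1) = (of_real r ^ 2 :: complex)"
    by simp
  have coeff1: "normalized_coeff k c p = c p / of_real r" using coeff[of 1] by simp
  have step: "c (p ^ Suc (Suc m)) = c p * c (p ^ Suc m) - of_real r ^ 2 * c (p ^ m)"
    using newform_coeff_recurrence[OF newform p(1), of "p ^ Suc m"] p p0 r2 by simp
  show ?thesis
    unfolding coeff coeff1 step using \<open>r > 0\<close> by (simp add: field_simps power2_eq_square)
qed

text \<open>These are the Chebyshev polynomials of the second kind at \<open>cos \<theta>\<close>;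
  the recurrence is the sum of the formulas for \<open>sin_add\<close> and
  \<open>sin_diff\<close>.\<close>

lemma prime_power_coeffs_eq_sin:
  fixes b :: "nat \<Rightarrow> complex"
  assumes "b 0 = 1" "b 1 = of_real (2 * cos \<theta>)" "\<And>m. b (Suc (Suc m)) = b 1 * b (Suc m) - b m"
    and "sin \<theta> \<noteq> 0"
  shows "b m = of_real (sin (real (Suc m) * \<theta>) / sin \<theta>)"
proof (induction m rule: induct_nat_012)
  case 0
  show ?case using assms(1,4) by simp
next
  case 1
  have "real (Suc 1) * \<theta> = 2 * \<theta>" by simp
  then have "sin (real (Suc 1) * \<theta>) / sin \<theta> = 2 * cos \<theta>"
    using assms(4) by (simp only: sin_double) simp
  then show ?case using assms(2) by simp
next
  case (ge2 m)
  have "sin (real (Suc (Suc (Suc m))) * \<theta>) =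
      2 * cos \<theta> * sin (real (Suc (Suc m)) * \<theta>) - sin (real (Suc m) * \<theta>)"
    using sin_add[of "real (Suc (Suc m)) * \<theta>" \<theta>] sin_diff[of "real (Suc (Suc m)) * \<theta>" \<theta>]
    by (simp add: algebra_simps)
  then have "sin (real (Suc (Suc (Suc m))) * \<theta>) / sin \<theta> =
      2 * cos \<theta> * (sin (real (Suc (Suc m)) * \<theta>) / sin \<theta>) - sin (real (Suc m) * \<theta>) / sin \<theta>"
    by (simp only: diff_divide_distrib times_divide_eq_right)
  then show ?case
    unfolding assms(3)[of m] ge2 assms(2) by (simp only: of_real_mult of_real_diff)
qed

text \<open>The degenerate case \<open>cos \<theta> = 1\<close> or \<open>cos \<theta> = -1\<close>,
  where the characteristic polynomial has a double root.\<close>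

lemma prime_power_coeffs_eq_linear:
  fixes b :: "nat \<Rightarrow> complex"
  assumes "b 0 = 1" "b 1 = of_real (2 * cos \<theta>)" "\<And>m. b (Suc (Suc m)) = b 1 * b (Suc m) - b m"
    and "sin \<theta> = 0"
  shows "b m = of_real (cos \<theta> ^ m * real (Suc m))"
proof (induction m rule: induct_nat_012)
  case (ge2 m)
  have "(cos \<theta>)\<^sup>2 = 1" using sin_cos_squared_add[of \<theta>] assms(4) by simp
  then have sq: "cos \<theta> ^ Suc (Suc m) = cos \<theta> ^ m" by (simp add: power2_eq_square)
  have "2 * cos \<theta> * (cos \<theta> ^ Suc m * real (Suc (Suc m))) = 2 * (cos \<theta> ^ Suc (Suc m) * real (Suc (Suc m)))"
    by simp
  then have "cos \<theta> ^ Suc (Suc m) * real (Suc (Suc (Suc m))) =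
      2 * cos \<theta> * (cos \<theta> ^ Suc m * real (Suc (Suc m))) - cos \<theta> ^ m * real (Suc m)"
    unfolding sq by (simp add: algebra_simps)
  then show ?case
    unfolding assms(3)[of m] ge2 assms(2) by (simp only: of_real_mult of_real_diff)
qed (use assms in simp_all)

subsection \<open>Badly approximable points\<close>

lemma Bad_I:
  assumes "0 < \<epsilon>" "\<And>m. m \<ge> 1 \<Longrightarrow> \<epsilon> \<le> (real m)\<^sup>2 * norm (a (p ^ m) - of_real x)"
  shows "x \<in> Bad a p"
proof -
  have "\<epsilon> \<le> (INF m\<in>{1..}. (real m)\<^sup>2 * norm (a (p ^ m) - of_real x))"
    using assms(2) by (intro cINF_greatest) auto
  with assms(1) show ?thesis by (simp add: Bad_def)
qed

text \<open>The tail stays away from \<open>x\<close> by \<open>ev\<close>, and finitely many values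
  remain, all different from \<open>x\<close>. Since \<open>x\<close> is positive, passing to
  \<open>\<bar>v m\<bar>\<close> only decreases the distance and removes alternating signs.\<close>

lemma Bad_if_discrete:
  assumes v: "\<And>m. a (p ^ m) = of_real (v m)"
    and x: "0 < x" "x \<notin> range v"
    and ev: "0 < \<epsilon>" "eventually (\<lambda>m. \<epsilon> \<le> \<bar>\<bar>v m\<bar> - x\<bar>) sequentially"
  shows "x \<in> Bad a p"
proof -
  obtain M where M: "\<And>m. M \<le> m \<Longrightarrow> \<epsilon> \<le> \<bar>\<bar>v m\<bar> - x\<bar>"
    using ev(2) by (auto simp: eventually_sequentially)
  define \<eta> where "\<eta> = Min (insert \<epsilon> ((\<lambda>m. \<bar>v m - x\<bar>) ` {..<M}))"
  have "0 < \<eta>" using ev(1) x by (auto simp: \<eta>_def)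
  have \<eta>: "\<eta> \<le> \<bar>v m - x\<bar>" for m
  proof (cases "m < M")
    case True
    then show ?thesis unfolding \<eta>_def by (intro Min_le) auto
  next
    case False
    have "\<eta> \<le> \<epsilon>" unfolding \<eta>_def by (intro Min_le) auto
    also have "\<dots> \<le> \<bar>\<bar>v m\<bar> - x\<bar>" using M False by simp
    also have "\<dots> \<le> \<bar>v m - x\<bar>" using x by linarith
    finally show ?thesis .
  qed
  have norm_eq: "norm (a (p ^ m) - of_real x) = \<bar>v m - x\<bar>" for m
    by (simp add: v norm_of_real flip: of_real_diff)
  show ?thesis
  proof (rule Bad_I[OF \<open>0 < \<eta>\<close>])
    fix m :: nat assume "m \<ge> 1"
    then have "1 * \<bar>v m - x\<bar> \<le> (real m)\<^sup>2 * \<bar>v m - x\<bar>" by (intro mult_right_mono) auto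
    then show "\<eta> \<le> (real m)\<^sup>2 * norm (a (p ^ m) - of_real x)" using \<eta>[of m] norm_eq by simp
  qed
qed

text \<open>The powers of \<open>\<bar>u\<bar>\<close> tend to 0, are constantly 1, or
  diverge.\<close>

lemma eventually_abs_power_apart:
  fixes u x :: real
  assumes "0 < x" "x \<noteq> 1"
  shows "\<exists>\<epsilon>>0. eventually (\<lambda>m. \<epsilon> \<le> \<bar>\<bar>u ^ m\<bar> - x\<bar>) sequentially"
proof -
  consider "\<bar>u\<bar> < 1" | "\<bar>u\<bar> = 1" | "\<bar>u\<bar> > 1" by linarith
  then show ?thesis
  proof cases
    case 1
    then have "(\<lambda>m. \<bar>u\<bar> ^ m) \<longlonglongrightarrow> 0" by (intro LIMSEQ_realpow_zero) auto
    then have "eventually (\<lambda>m. \<bar>u\<bar> ^ m < x / 2) sequentially"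
      by (rule order_tendstoD(2)) (use assms in simp)
    then have "eventually (\<lambda>m. x / 2 \<le> \<bar>\<bar>u ^ m\<bar> - x\<bar>) sequentially"
    proof eventually_elim
      case (elim m)
      then show ?case unfolding power_abs by linarith
    qed
    then show ?thesis using assms by (intro exI[of _ "x / 2"]) auto
  next
    case 2
    then show ?thesis using assms by (intro exI[of _ "\<bar>1 - x\<bar>"]) (simp add: power_abs)
  next
    case 3
    obtain M where M: "x + 1 < \<bar>u\<bar> ^ M" using real_arch_pow[OF 3] by blast
    have "eventually (\<lambda>m. x + 1 \<le> \<bar>u\<bar> ^ m) sequentially"
      using eventually_ge_at_top[of M]
    proof eventually_elim
      case (elim m)
      then have "\<bar>u\<bar> ^ M \<le> \<bar>u\<bar> ^ m" using 3 by (intro power_increasing) auto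
      with M show ?case by simp
    qed
    then have "eventually (\<lambda>m. 1 \<le> \<bar>\<bar>u ^ m\<bar> - x\<bar>) sequentially"
      by eventually_elim (simp add: power_abs)
    then show ?thesis by (intro exI[of _ 1]) auto
  qed
qed

lemma alpha_winning_in_mono:
  assumes "alpha_winning_in \<alpha> I X" "X \<subseteq> Y" "Y \<subseteq> I"
  shows "alpha_winning_in \<alpha> I Y"
proof -
  obtain \<sigma> where "A_strategy \<alpha> \<sigma>"
      and "\<And>\<beta> B. \<beta> \<in> {0<..<1} \<Longrightarrow> B_play \<beta> I \<sigma> B \<Longrightarrow> \<exists>x\<in>X. (\<Inter>s. B s) = {x}"
    using assms(1) unfolding alpha_winning_in_def by auto
  then have "A_strategy \<alpha> \<sigma> \<and>
      (\<forall>\<beta>\<in>{0<..<1}. \<forall>B. B_play \<beta> I \<sigma> B \<longrightarrow> (\<exists>x\<in>Y. (\<Inter>s. B s) = {x}))"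
    using assms(2) by (metis subsetD)
  with assms(3) show ?thesis unfolding alpha_winning_in_def by auto
qed

lemma winning_if_discrete:
  assumes v: "\<And>m. a (p ^ m) = of_real (v m)" and I: "I \<subseteq> {0<..}"
    and ev: "\<And>x. x \<in> I \<Longrightarrow> x \<notin> range v \<Longrightarrow>
      \<exists>\<epsilon>>0. eventually (\<lambda>m. \<epsilon> \<le> \<bar>\<bar>v m\<bar> - x\<bar>) sequentially"
  shows "alpha_winning_in (1 / 5) I (Bad a p \<inter> I)"
proof (rule alpha_winning_in_mono[OF winning_avoid_countable])
  show "I - range v \<subseteq> Bad a p \<inter> I"
  proof
    fix x assume x: "x \<in> I - range v"
    then obtain \<epsilon> where "0 < \<epsilon>" "eventually (\<lambda>m. \<epsilon> \<le> \<bar>\<bar>v m\<bar> - x\<bar>) sequentially"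
      using ev[of x] by auto
    then have "x \<in> Bad a p"
      using x I by (intro Bad_if_discrete[of a p v x \<epsilon>] v) auto
    with x show "x \<in> Bad a p \<inter> I" by simp
  qed
qed simp

section \<open>The cases of the prime and its angle\<close>

theorem theorem3:
  fixes N p :: nat and k :: int
    and f :: "complex \<Rightarrow> complex" and a_f a :: "nat \<Rightarrow> complex" and \<theta> :: "nat \<Rightarrow> real"
  assumes "N \<ge> 1" and "even k"
    and "is_newform N k f"
    and "has_fourier_coeffs f a_f"
    and "a_f 1 = 1"
    and "a = normalized_coeff k a_f"
    and "\<And>q. prime q \<Longrightarrow> \<theta> q \<in> {0..pi} \<and> a q = of_real (2 * cos (\<theta> q))"
    and "prime p"
  shows "winning_in (target_interval (\<theta> p)) (Bad a p \<inter> target_interval (\<theta> p))"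
proof -
  define t where "t = \<theta> p"
  define I where "I = target_interval t"
  have "0 \<le> t" "t \<le> pi" and ap: "a p = of_real (2 * cos t)"
    using assms(7)[OF assms(8)] by (auto simp: t_def)
  then have "0 \<le> sin t" by (intro sin_ge_zero)
  have I_pos: "I \<subseteq> {0<..}" by (auto simp: I_def target_interval_def)
  have "alpha_winning_in (1 / 5) I (Bad a p \<inter> I)"
  proof (cases "p dvd N")
    case True
    show ?thesis
    proof (rule winning_if_discrete[where v = "\<lambda>m. (2 * cos t) ^ m"])
      show "a (p ^ m) = of_real ((2 * cos t) ^ m)" for m
        unfolding of_real_power ap[symmetric] assms(6)
        by (rule newform_prime_powers_dvd_level[OF assms(3-5,8) True])
      show "\<exists>\<epsilon>>0. eventually (\<lambda>m. \<epsilon> \<le> \<bar>\<bar>(2 * cos t) ^ m\<bar> - x\<bar>) sequentially"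
        if "x \<in> I" "x \<notin> range (\<lambda>m. (2 * cos t) ^ m)" for x
      proof (rule eventually_abs_power_apart)
        show "0 < x" using that I_pos by auto
        \<comment> \<open>The value at \<open>m = 0\<close> is 1, so it is among the avoided
          ones.\<close>
        show "x \<noteq> 1" using that(2) by (metis power_0 rangeI)
      qed
    qed (rule I_pos)
  next
    case False
    have rec: "a (p ^ 0) = 1" "a (p ^ 1) = of_real (2 * cos t)"
        "\<And>m. a (p ^ Suc (Suc m)) = a (p ^ 1) * a (p ^ Suc m) - a (p ^ m)"
      using assms(5) ap newform_prime_powers_recurrence[OF assms(3-5,8) False]
      unfolding assms(6) by (simp_all only: power_0 power_one_right) (simp add: normalized_coeff_def)
    show ?thesis
    proof (cases "sin t = 0")
      case True
      have "\<bar>cos t\<bar> = 1" using sin_cos_squared_add[of t] True by (auto simp: power2_eq_1_iff)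
      show ?thesis
      proof (rule winning_if_discrete[where v = "\<lambda>m. cos t ^ m * real (Suc m)"])
        show "a (p ^ m) = of_real (cos t ^ m * real (Suc m))" for m
          by (rule prime_power_coeffs_eq_linear[where b = "\<lambda>m. a (p ^ m)", OF rec True])
        show "\<exists>\<epsilon>>0. eventually (\<lambda>m. \<epsilon> \<le> \<bar>\<bar>cos t ^ m * real (Suc m)\<bar> - x\<bar>) sequentially" for x
        proof (intro exI conjI)
          show "eventually (\<lambda>m. 1 \<le> \<bar>\<bar>cos t ^ m * real (Suc m)\<bar> - x\<bar>) sequentially"
            using eventually_ge_at_top[of "nat \<lceil>x\<rceil>"]
          proof eventually_elim
            case (elim m)
            then have "x \<le> real m" by linarith
            then show ?case using \<open>\<bar>cos t\<bar> = 1\<close> by (simp add: abs_mult power_abs)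
          qed
        qed simp
      qed (rule I_pos)
    next
      case False
      then have sin_pos: "0 < sin t" using \<open>0 \<le> sin t\<close> by simp
      have I: "I = {0<..<1 / (2 * sin t)}"
        using sin_pos by (auto simp: I_def target_interval_def one_ereal_def)
      have a_eq: "a (p ^ m) = of_real (sin (real (Suc m) * t) / sin t)" for m
        by (rule prime_power_coeffs_eq_sin[where b = "\<lambda>m. a (p ^ m)", OF rec False])
      have "x \<in> Bad a p"
        if "0 < c" and c: "\<And>n. n \<ge> 1 \<Longrightarrow> c \<le> real n * \<bar>x - sin (real n * t) / sin t\<bar>" for x c
      proof (rule Bad_I[of "c / 2"])
        fix m :: nat assume m: "m \<ge> 1"
        have norm_eq: "norm (a (p ^ m) - of_real x) = \<bar>x - sin (real (Suc m) * t) / sin t\<bar>"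
          unfolding a_eq of_real_diff[symmetric] norm_of_real by simp
        have "1 \<le> real m" using m by simp
        moreover have "real m \<le> (real m)\<^sup>2" by (rule self_le_power) (use m in auto)
        \<comment> \<open>The coefficient at \<open>p ^ m\<close> is the sine quotient of index
          \<open>m + 1\<close>; this comparison turns the linear bound \<open>c\<close> into the
          quadratic bound \<open>c / 2\<close>.\<close>
        ultimately have "real (Suc m) \<le> 2 * (real m)\<^sup>2" unfolding of_nat_Suc by linarith
        then have "real (Suc m) * norm (a (p ^ m) - of_real x) \<le> 2 * (real m)\<^sup>2 * norm (a (p ^ m) - of_real x)"
          by (intro mult_right_mono) auto
        then show "c / 2 \<le> (real m)\<^sup>2 * norm (a (p ^ m) - of_real x)"
          using c[of "Suc m"] norm_eq by simp
      qed (use \<open>0 < c\<close> in simp)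
      then have "{x \<in> I. \<exists>c>0. \<forall>n\<ge>1. c \<le> real n * \<bar>x - sin (real n * t) / sin t\<bar>} \<subseteq> Bad a p \<inter> I"
        by blast
      with winning_sin_quotients[OF sin_pos] show ?thesis
        unfolding I[symmetric] by (rule alpha_winning_in_mono) simp
    qed
  qed
  then have "winning_in I (Bad a p \<inter> I)"
    unfolding winning_in_def by (intro bexI[of _ "1 / 5"]) auto
  then show ?thesis by (simp add: I_def t_def)
qed

end
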